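(* For all characters $A,B,B',C\in\widehat{\mathbb F_q}$ and all $x,y\in\mathbb F_q\setminus\{0,1\}$, $$\mathbb F_1(A;B,B';C;x,y)=BB'(-1)\;\mathbb F_1(A;B,B';ABB'\overline C;1-x,1-y).$$
   Context: Let $p$ be a prime, $r\ge1$ an integer, $q=p^r$, and $\mathbb F_q$ the finite field with $q$ elements. $\widehat{\mathbb F_q}$ denotes the group of (complex-valued) multiplicative characters of $\mathbb F_q^*$; every character $\chi$, including the trivial character $\varepsilon$, is extended to $\mathbb F_q$ by $\chi(0)=0$. $\overline\chi$ is the inverse of $\chi$. Juxtaposition of characters denotes their product, and e.g. $AC(-1)$ means $(AC)(-1)$, $\overline AC$ means the product of $\overline A$ and $C$. For $A,B,B',C\in\widehat{\mathbb F_q}$ and $x,y\in\mathbb F_q$, $$\mathbb F_1(A;B,B';C;x,y)=\varepsilon(xy)\,AC(-1)\sum_{u\in\mathbb F_q}A(u)\,\overline AC(1-u)\,\overline B(1-ux)\,\overline{B'}(1-uy).$$ *)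

theory Defs
  imports
    "HOL.Complex"
    "HOL-Computational_Algebra.Primes"
    "HOL-Library.Cardinality"
    "HOL-Library.Function_Algebras"
    "HOL-Library.Function_Division"
begin

text \<open>
  Homomorphisms from the multiplicative group of the field to the nonzero complex numbers,
  extended by \<open>0\<close> to the whole field. Products and inverses of characters are the pointwise
  ones of \<open>Function_Algebras\<close> and \<open>Function_Division\<close>; since \<open>inverse 0 = 0\<close>, both
  respect the extension by zero. Beware that the constant function \<open>1\<close> of
  \<open>Function_Algebras\<close> is not the trivial character, whose value at \<open>0\<close> is \<open>0\<close>.
\<close>

definition mult_chars :: "('a::{field,finite} \<Rightarrow> complex) set" where
  "mult_chars = {\<chi>. \<chi> 0 = 0 \<and> (\<forall>a. a \<noteq> 0 \<longrightarrow> \<chi> a \<noteq> 0) \<and>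
      (\<forall>a b. a \<noteq> 0 \<longrightarrow> b \<noteq> 0 \<longrightarrow> \<chi> (a * b) = \<chi> a * \<chi> b)}"

definition trivial_char :: "'a::{field,finite} \<Rightarrow> complex" where
  "trivial_char a = (if a = 0 then 0 else 1)"

lemma trivial_char_in_mult_chars: "trivial_char \<in> mult_chars"
  by (simp add: mult_chars_def trivial_char_def)

lemma times_in_mult_chars:
  "\<chi> \<in> mult_chars \<Longrightarrow> \<psi> \<in> mult_chars \<Longrightarrow> \<chi> * \<psi> \<in> mult_chars"
  by (simp add: mult_chars_def)

lemma inverse_in_mult_chars: "\<chi> \<in> mult_chars \<Longrightarrow> inverse \<chi> \<in> mult_chars"
  by (simp add: mult_chars_def inverse_fun_def)

lemma trivial_char_times: "\<chi> \<in> mult_chars \<Longrightarrow> trivial_char * \<chi> = \<chi>"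
  by (auto simp: mult_chars_def trivial_char_def fun_eq_iff)

lemma inverse_times_char: "\<chi> \<in> mult_chars \<Longrightarrow> inverse \<chi> * \<chi> = trivial_char"
  by (auto simp: mult_chars_def trivial_char_def inverse_fun_def fun_eq_iff)

definition appell_F1 ::
  "('a::{field,finite} \<Rightarrow> complex) \<Rightarrow> ('a \<Rightarrow> complex) \<Rightarrow> ('a \<Rightarrow> complex) \<Rightarrow> ('a \<Rightarrow> complex) \<Rightarrow>
   'a \<Rightarrow> 'a \<Rightarrow> complex" where
  "appell_F1 A B B' C x y =
     trivial_char (x * y) * (A * C) (- 1) *
     (\<Sum>u\<in>UNIV. A u * (inverse A * C) (1 - u) * (inverse B) (1 - u * x) * (inverse B') (1 - u * y))"

end

theory Submission
  imports Defs
begin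

text \<open>
  The identity is the finite field analogue of the substitution \<open>u = v / (v - 1)\<close> in the Euler
  integral of the Appell function. This Moebius map is an involution of the field without the
  point \<open>1\<close>, and it satisfies
  \<open>1 - u = 1 / (1 - v)\<close> and \<open>1 - u * x = (1 - v * (1 - x)) / (1 - v)\<close>, so it replaces \<open>x\<close> and \<open>y\<close>
  by \<open>1 - x\<close> and \<open>1 - y\<close> at the price of powers of \<open>1 - v\<close>. These powers collect to the character
  \<open>B B' / C\<close>, which is \<open>C' / A\<close> for the new parameter \<open>C' = A B B' / C\<close>. The factor \<open>-1\<close> in
  \<open>u = - (v / (1 - v))\<close> contributes \<open>A (-1)\<close>; since the value of a character at \<open>-1\<close> is its own
  inverse, the constants in front of the two sums then agree. Removing the point \<open>1\<close> from both
  sums changes neither, because each summand contains a character evaluated at \<open>1 - u\<close>.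
\<close>

lemma mult_char_zero: "\<chi> \<in> mult_chars \<Longrightarrow> \<chi> 0 = 0"
  by (simp add: mult_chars_def)

lemma mult_char_nonzero: "\<chi> \<in> mult_chars \<Longrightarrow> a \<noteq> 0 \<Longrightarrow> \<chi> a \<noteq> 0"
  by (simp add: mult_chars_def)

lemma mult_char_mult: "\<chi> \<in> mult_chars \<Longrightarrow> \<chi> (a * b) = \<chi> a * \<chi> b"
  by (cases "a = 0"; cases "b = 0") (auto simp: mult_chars_def)

lemma mult_char_one: "\<chi> \<in> mult_chars \<Longrightarrow> \<chi> 1 = 1"
  using mult_char_mult[of \<chi> 1 1] mult_char_nonzero[of \<chi> 1] by simp

lemma mult_char_divide:
  assumes "\<chi> \<in> mult_chars"
  shows "\<chi> (a / b) = \<chi> a / \<chi> b"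
proof (cases "b = 0")
  case True
  then show ?thesis by (simp add: mult_char_zero[OF assms])
next
  case False
  then have "\<chi> (a / b) * \<chi> b = \<chi> a"
    by (simp flip: mult_char_mult[OF assms])
  then show ?thesis
    using mult_char_nonzero[OF assms False] by (simp add: field_simps)
qed

lemma mult_char_minus_one_square: "\<chi> \<in> mult_chars \<Longrightarrow> \<chi> (- 1) * \<chi> (- 1) = 1"
  by (simp add: mult_char_one flip: mult_char_mult)

lemma mult_char_minus_one_inverse: "\<chi> \<in> mult_chars \<Longrightarrow> inverse (\<chi> (- 1)) = \<chi> (- 1)"
  by (simp add: inverse_unique mult_char_minus_one_square)

lemma bij_betw_divide_diff_one:
  "bij_betw (\<lambda>v :: 'a :: field. v / (v - 1)) (UNIV - {1}) (UNIV - {1})"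
  by (rule bij_betw_byWitness[where f' = "\<lambda>v. v / (v - 1)"]) (auto simp: field_simps)

text \<open>
  Multiplicativity splits each argument into its numerator and the denominator \<open>1 - v\<close>. No case
  distinction on vanishing factors arises: characters respect quotients also with numerator
  \<open>0\<close>, and the only value cancelled is that of \<open>A\<close> at \<open>1 - v\<close>.
\<close>

lemma appell_summand_substitution:
  fixes A B B' C :: "'a::{field,finite} \<Rightarrow> complex"
  assumes A: "A \<in> mult_chars" and B: "B \<in> mult_chars" and B': "B' \<in> mult_chars"
    and C: "C \<in> mult_chars" and v: "v \<noteq> 1"
  defines "u \<equiv> v / (v - 1)"
  shows "A u * (inverse A * C) (1 - u) * (inverse B) (1 - u * x) * (inverse B') (1 - u * y) =
    A (- 1) * (A v * (inverse A * (A * B * B' * inverse C)) (1 - v) *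
      (inverse B) (1 - v * (1 - x)) * (inverse B') (1 - v * (1 - y)))"
proof -
  have "1 - v \<noteq> 0" "v - 1 \<noteq> 0" using v by auto
  then have u: "u = (- 1) * (v / (1 - v))" "1 - u = 1 / (1 - v)"
    and lin: "\<And>z. 1 - u * z = (1 - v * (1 - z)) / (1 - v)"
    unfolding u_def by (simp_all add: divide_simps) (simp_all add: algebra_simps)
  have char_u: "A u = A (- 1) * (A v / A (1 - v))"
    unfolding u(1) mult_char_mult[OF A] mult_char_divide[OF A] ..
  have char_1u: "A (1 - u) = 1 / A (1 - v)" "C (1 - u) = 1 / C (1 - v)"
    using A C by (simp_all add: u(2) mult_char_divide mult_char_one)
  have char_1ux: "B (1 - u * x) = B (1 - v * (1 - x)) / B (1 - v)"
    "B' (1 - u * y) = B' (1 - v * (1 - y)) / B' (1 - v)"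
    using B B' by (simp_all add: lin mult_char_divide)
  have "A (1 - v) \<noteq> 0"
    using A \<open>1 - v \<noteq> 0\<close> by (rule mult_char_nonzero)
  then show ?thesis
    by (simp only: times_fun_def inverse_fun_def comp_apply char_u char_1u char_1ux)
      (simp add: divide_inverse mult_ac)
qed

theorem theorem3p4:
  fixes p r :: nat
    and A B B' C :: "'a::{field,finite} \<Rightarrow> complex"
    and x y :: 'a
  assumes "prime p" and "r \<ge> 1" and "CARD('a) = p ^ r"
    and "A \<in> mult_chars" and "B \<in> mult_chars" and "B' \<in> mult_chars" and "C \<in> mult_chars"
    and "x \<in> UNIV - {0, 1}" and "y \<in> UNIV - {0, 1}"
  shows "appell_F1 A B B' C x y =
    (B * B') (- 1) * appell_F1 A B B' (A * B * B' * inverse C) (1 - x) (1 - y)"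
proof -
  note A = assms(4) and B = assms(5) and B' = assms(6) and C = assms(7)
  define D where "D = A * B * B' * inverse C"
  define S where "S E x y u = A u * (inverse A * E) (1 - u) *
    (inverse B) (1 - u * x) * (inverse B') (1 - u * y)" for E x y u
  have remove_one: "(\<Sum>u\<in>UNIV. S E x y u) = (\<Sum>u\<in>UNIV - {1}. S E x y u)" for E x y
    by (rule sum.mono_neutral_right) (auto simp: S_def inverse_fun_def mult_char_zero[OF A])
  have "(\<Sum>u\<in>UNIV. S C x y u) = (\<Sum>v\<in>UNIV - {1}. S C x y (v / (v - 1)))"
    unfolding remove_one using bij_betw_divide_diff_one
    by (rule sum.reindex_bij_betw[symmetric])
  also have "\<dots> = (\<Sum>v\<in>UNIV - {1}. A (- 1) * S D (1 - x) (1 - y) v)"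
    using appell_summand_substitution[OF A B B' C] by (intro sum.cong) (auto simp: S_def D_def)
  also have "\<dots> = A (- 1) * (\<Sum>v\<in>UNIV. S D (1 - x) (1 - y) v)"
    by (simp add: remove_one sum_distrib_left)
  finally have sums: "(\<Sum>u\<in>UNIV. S C x y u) = A (- 1) * (\<Sum>v\<in>UNIV. S D (1 - x) (1 - y) v)" .
  have "(A * C) (- 1) * A (- 1) = (A (- 1) * A (- 1)) * C (- 1)"
    by simp
  also have "\<dots> = (A (- 1) * A (- 1)) * (B (- 1) * B (- 1)) * (B' (- 1) * B' (- 1)) * C (- 1)"
    by (simp only: mult_char_minus_one_square[OF A] mult_char_minus_one_square[OF B]
        mult_char_minus_one_square[OF B'] mult_1_left)
  also have "\<dots> = (B * B') (- 1) * (A * D) (- 1)"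
    by (simp add: D_def inverse_fun_def mult_char_minus_one_inverse[OF C] mult_ac)
  finally have constants: "(A * C) (- 1) * A (- 1) = (B * B') (- 1) * (A * D) (- 1)" .
  have "x * y \<noteq> 0" "(1 - x) * (1 - y) \<noteq> 0"
    using assms(8,9) by auto
  then have "appell_F1 A B B' C x y = (A * C) (- 1) * (\<Sum>u\<in>UNIV. S C x y u)"
    and "appell_F1 A B B' D (1 - x) (1 - y) = (A * D) (- 1) * (\<Sum>u\<in>UNIV. S D (1 - x) (1 - y) u)"
    by (simp_all add: appell_F1_def S_def trivial_char_def)
  then show ?thesis
    unfolding D_def[symmetric] sums using constants by (simp only: mult.assoc[symmetric])
qed

end
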